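(* Let $H = H_3$ be the discrete Heisenberg group, with generating set $S = \{(0,0,0),(1,0,0),(0,1,0),(-1,0,0),(0,-1,0)\}$. Then the set $P = H\setminus(\{0\}\times\{0\}\times\mathbb{N})$ is a non-Busemann horoball, i.e. $P$ is an $S$-horoball and $P$ is not a Busemann horoball (with respect to $S$).
   Context: $H_3$ is the set of $(a,b,c)\in\mathbb{Z}^3$ such that $2\mid c\iff 2\mid ab$, with product $(a,b,c)(a',b',c') = (a+a',b+b',c+c'+(ab'-a'b))$. Here $\mathbb{N} = \{0,1,2,\dots\}$. For a group $G$ with finite symmetric generating set $S\ni e_G$, $|g|_S$ is the minimal $\ell\ge0$ such that $g$ is a product of $\ell$ elements of $S$, $d_S(g,h) = |g^{-1}h|_S$, and $B_{S,r}(g) = \{h : d_S(g,h)\le r\}$. Subsets of $G$ carry the product (Cantor) topology of $\{0,1\}^G$: $P_i\to P$ means that for each $g\in G$, $g\in P_i\iff g\in P$ for all large $i$. An infinite geodesic is a map $p:\mathbb{N}\to G$ with $p(i+1)\in p(i)S$ for all $i$ and $d_S(p(0),p(n)) = n$ for all $n$. Let $P\subset G$ with $P\ne\emptyset,G$. $P$ is a Busemann horoball if $P=\bigcup_n B_{S,n}(p(n))$ for some infinite geodesic $p$. $P$ is an $S$-horoball if $P = \lim_i B_{S,n_i}(g_i)$ for some $g_i\in G$, $n_i\in\mathbb{N}$ with $n_i\to\infty$. *)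

theory Defs
  imports Complex_Main "HOL-Algebra.Coset"
begin

definition word_prod :: "('a, 'b) monoid_scheme \<Rightarrow> 'a list \<Rightarrow> 'a" where
  "word_prod G ws = foldr (mult G) ws \<one>\<^bsub>G\<^esub>"

text \<open>
  Intended for a group \<open>G\<close> and a finite symmetric generating set \<open>S\<close> containing the identity.
  For an element that is not a product of elements of \<open>S\<close>, the value is unspecified.
\<close>

definition word_length :: "('a, 'b) monoid_scheme \<Rightarrow> 'a set \<Rightarrow> 'a \<Rightarrow> nat" where
  "word_length G S g = (LEAST l. \<exists>ws. set ws \<subseteq> S \<and> length ws = l \<and> word_prod G ws = g)"

definition word_dist :: "('a, 'b) monoid_scheme \<Rightarrow> 'a set \<Rightarrow> 'a \<Rightarrow> 'a \<Rightarrow> nat" where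
  "word_dist G S g h = word_length G S (inv\<^bsub>G\<^esub> g \<otimes>\<^bsub>G\<^esub> h)"

definition word_ball :: "('a, 'b) monoid_scheme \<Rightarrow> 'a set \<Rightarrow> nat \<Rightarrow> 'a \<Rightarrow> 'a set" where
  "word_ball G S r g = {h \<in> carrier G. word_dist G S g h \<le> r}"

text \<open>Convergence in the product topology of \<open>{0,1}\<^sup>G\<close>, i.e. pointwise in \<open>g\<close>.\<close>

definition set_converges ::
    "('a, 'b) monoid_scheme \<Rightarrow> (nat \<Rightarrow> 'a set) \<Rightarrow> 'a set \<Rightarrow> bool" where
  "set_converges G X P \<longleftrightarrow>
     (\<forall>g \<in> carrier G. eventually (\<lambda>i. g \<in> X i \<longleftrightarrow> g \<in> P) sequentially)"

definition infinite_geodesic ::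
    "('a, 'b) monoid_scheme \<Rightarrow> 'a set \<Rightarrow> (nat \<Rightarrow> 'a) \<Rightarrow> bool" where
  "infinite_geodesic G S p \<longleftrightarrow>
     range p \<subseteq> carrier G \<and>
     (\<forall>i. p (i + 1) \<in> p i <#\<^bsub>G\<^esub> S) \<and>
     (\<forall>n. word_dist G S (p 0) (p n) = n)"

definition busemann_horoball ::
    "('a, 'b) monoid_scheme \<Rightarrow> 'a set \<Rightarrow> 'a set \<Rightarrow> bool" where
  "busemann_horoball G S P \<longleftrightarrow>
     P \<subseteq> carrier G \<and> P \<noteq> {} \<and> P \<noteq> carrier G \<and>
     (\<exists>p. infinite_geodesic G S p \<and> P = (\<Union>n. word_ball G S n (p n)))"

definition horoball ::
    "('a, 'b) monoid_scheme \<Rightarrow> 'a set \<Rightarrow> 'a set \<Rightarrow> bool" where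
  "horoball G S P \<longleftrightarrow>
     P \<subseteq> carrier G \<and> P \<noteq> {} \<and> P \<noteq> carrier G \<and>
     (\<exists>g n. range g \<subseteq> carrier G \<and> filterlim n at_top sequentially \<and>
            set_converges G (\<lambda>i. word_ball G S (n i) (g i)) P)"

definition heis :: "(int \<times> int \<times> int) monoid" where
  "heis =
     \<lparr>carrier = {(a, b, c). 2 dvd c \<longleftrightarrow> 2 dvd a * b},
      mult = (\<lambda>(a, b, c) (a', b', c'). (a + a', b + b', c + c' + (a * b' - a' * b))),
      one = (0, 0, 0)\<rparr>"

definition heis_gens :: "(int \<times> int \<times> int) set" where
  "heis_gens = {(0, 0, 0), (1, 0, 0), (0, 1, 0), (-1, 0, 0), (0, -1, 0)}"

lemma heis_carrier: "(a, b, c) \<in> carrier heis \<longleftrightarrow> (2 dvd c \<longleftrightarrow> 2 dvd a * b)"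
  by (simp add: heis_def)

lemma heis_mult [simp]:
  "(a, b, c) \<otimes>\<^bsub>heis\<^esub> (a', b', c') = (a + a', b + b', c + c' + (a * b' - a' * b))"
  by (simp add: heis_def)

lemma heis_one [simp]: "\<one>\<^bsub>heis\<^esub> = (0, 0, 0)"
  by (simp add: heis_def)

lemma heis_group: "group heis"
proof (rule groupI)
  fix x y assume "x \<in> carrier heis" "y \<in> carrier heis"
  then show "x \<otimes>\<^bsub>heis\<^esub> y \<in> carrier heis"
    by (cases x; cases y) (auto simp: heis_carrier)
next
  fix x assume x: "x \<in> carrier heis"
  obtain a b c where "x = (a, b, c)" by (cases x)
  with x show "\<exists>y\<in>carrier heis. y \<otimes>\<^bsub>heis\<^esub> x = \<one>\<^bsub>heis\<^esub>"
    by (intro bexI[of _ "(-a, -b, -c)"]) (auto simp: heis_carrier)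
qed (auto simp: heis_carrier algebra_simps)

lemma heis_inv:
  assumes "(a, b, c) \<in> carrier heis"
  shows "inv\<^bsub>heis\<^esub> (a, b, c) = (-a, -b, -c)"
  using assms
  by (intro group.inv_equality[OF heis_group]) (auto simp: heis_carrier)

lemma heis_gens_finite: "finite heis_gens"
  by (simp add: heis_gens_def)

lemma heis_gens_carrier: "heis_gens \<subseteq> carrier heis"
  by (auto simp: heis_gens_def heis_carrier)

lemma heis_gens_one: "\<one>\<^bsub>heis\<^esub> \<in> heis_gens"
  by (simp add: heis_gens_def)

lemma heis_gens_symmetric:
  assumes "s \<in> heis_gens" shows "inv\<^bsub>heis\<^esub> s \<in> heis_gens"
  using assms by (auto simp: heis_gens_def heis_inv heis_carrier)

lemma heis_word_prod_append:
  "word_prod heis (us @ vs) = word_prod heis us \<otimes>\<^bsub>heis\<^esub> word_prod heis vs"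
proof (induction us)
  case Nil
  then show ?case by (cases "word_prod heis vs") (simp add: word_prod_def)
next
  case (Cons u us)
  then show ?case
    by (cases u; cases "word_prod heis us"; cases "word_prod heis vs")
       (simp add: word_prod_def algebra_simps)
qed

lemma heis_gens_generate:
  assumes "g \<in> carrier heis"
  shows "\<exists>ws. set ws \<subseteq> heis_gens \<and> word_prod heis ws = g"
proof -
  define W where "W = {g. \<exists>ws. set ws \<subseteq> heis_gens \<and> word_prod heis ws = g}"
  have mult: "x \<otimes>\<^bsub>heis\<^esub> y \<in> W" if "x \<in> W" "y \<in> W" for x y
    using that unfolding W_def by (clarsimp) (metis heis_word_prod_append set_append Un_least)
  have gens: "x \<in> W" if "x \<in> heis_gens" for x
    unfolding W_def using that
    by (intro CollectI exI[of _ "[x]"]) (cases x, simp add: word_prod_def)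
  have x: "(1, 0, 0) \<in> W" "(-1, 0, 0) \<in> W" and y: "(0, 1, 0) \<in> W" "(0, -1, 0) \<in> W"
    and e: "(0, 0, 0) \<in> W"
    by (auto intro!: gens simp: heis_gens_def)
  have z: "(0, 0, 2) \<in> W"
    using mult[OF mult[OF x(1) y(1)] mult[OF x(2) y(2)]] by simp
  have z': "(0, 0, -2) \<in> W"
    using mult[OF mult[OF y(1) x(1)] mult[OF y(2) x(2)]] by simp
  have X: "(a, 0, 0) \<in> W" for a
  proof (induction a rule: int_induct[of _ 0])
    case (step1 i) then show ?case using mult[OF _ x(1), of "(i, 0, 0)"] by simp
  next
    case (step2 i) then show ?case using mult[OF _ x(2), of "(i, 0, 0)"] by simp
  qed (rule e)
  have Y: "(0, b, 0) \<in> W" for b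
  proof (induction b rule: int_induct[of _ 0])
    case (step1 i) then show ?case using mult[OF _ y(1), of "(0, i, 0)"] by simp
  next
    case (step2 i) then show ?case using mult[OF _ y(2), of "(0, i, 0)"] by simp
  qed (rule e)
  have Z: "(0, 0, 2 * k) \<in> W" for k
  proof (induction k rule: int_induct[of _ 0])
    case (step1 i) then show ?case
      using mult[OF _ z, of "(0, 0, 2 * i)"] by (simp add: algebra_simps)
  next
    case (step2 i) then show ?case
      using mult[OF _ z', of "(0, 0, 2 * i)"] by (simp add: algebra_simps)
  qed (simp add: e)
  obtain a b c where g: "g = (a, b, c)" by (cases g)
  have "even (c - a * b)" using assms by (simp add: g heis_carrier)
  then obtain k where k: "c - a * b = 2 * k" by (elim evenE)
  have "g \<in> W"
    using mult[OF mult[OF X[of a] Y[of b]] Z[of k]] k by (simp add: g algebra_simps)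
  then show ?thesis by (simp add: W_def)
qed

end

theory Submission imports Defs begin

text \<open>
  A word of length at most \<open>l\<close> representing \<open>(a, b, c)\<close> is a lattice path from the origin to
  \<open>(a, b)\<close>, and \<open>c\<close> is twice the signed area between the path and its chord. Such a path exists
  iff some \<open>p\<close> by \<open>q\<close> rectangle satisfies \<open>p \<ge> |a|\<close>, \<open>q \<ge> |b|\<close>, \<open>2p + 2q - |a| - |b| \<le> l\<close> and
  \<open>|c| \<le> 2pq - |ab|\<close>: the path runs around the rectangle, with a notch cut out to adjust the area.

  The length of \<open>(0, 0, c)\<close> jumps just above \<open>c = 2k\<^sup>2\<close>, where the area exceeds that of the square
  of perimeter \<open>4k\<close>. Hence the balls of radius \<open>4k + 1\<close> around \<open>(0, 0, -2k\<^sup>2 - 2)\<close> converge to \<open>P\<close>.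

  If \<open>P\<close> were the Busemann horoball of a geodesic \<open>p\<close>, then for all large \<open>n\<close> the inverse
  \<open>(a, b, c)\<close> of \<open>p n\<close> would have length greater than \<open>n\<close> while its products with the nine elements
  of \<open>probes\<close>, which lie in \<open>P\<close>, have length at most \<open>n\<close>. For \<open>a > 0\<close> and \<open>b \<ge> 0\<close> this forces
  \<open>c = 2ak - ab + 2\<close> and \<open>n = a + 2k - b + 1\<close> with \<open>b < k \<le> a - 2\<close>. Passing from \<open>n\<close> to \<open>n + 1\<close>
  multiplies by a generator on the left, and the two equations leave only the generator
  \<open>(0, -1, 0)\<close>. So \<open>b\<close> would decrease forever within the quadrant, which is absurd. The other
  quadrants follow by rotation.
\<close>

section \<open>Words of bounded length and the symmetries of the generating set\<close>

definition reach :: "nat \<Rightarrow> int \<times> int \<times> int \<Rightarrow> bool" where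
  "reach l g \<longleftrightarrow> (\<exists>ws. set ws \<subseteq> heis_gens \<and> length ws \<le> l \<and> word_prod heis ws = g)"

lemma word_length_le_iff:
  assumes "g \<in> carrier heis"
  shows "word_length heis heis_gens g \<le> l \<longleftrightarrow> reach l g"
proof
  have "\<exists>l ws. set ws \<subseteq> heis_gens \<and> length ws = l \<and> word_prod heis ws = g"
    using heis_gens_generate[OF assms] by blast
  then have "\<exists>ws. set ws \<subseteq> heis_gens \<and> length ws = word_length heis heis_gens g
      \<and> word_prod heis ws = g"
    unfolding word_length_def by (rule LeastI_ex)
  then show "reach l g" if "word_length heis heis_gens g \<le> l"
    using that unfolding reach_def by auto
next
  assume "reach l g"
  then obtain ws where ws: "set ws \<subseteq> heis_gens" "length ws \<le> l" "word_prod heis ws = g"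
    unfolding reach_def by blast
  then have "word_length heis heis_gens g \<le> length ws"
    unfolding word_length_def by (intro Least_le) blast
  with ws show "word_length heis heis_gens g \<le> l" by simp
qed

lemma reach_mono: "reach l g \<Longrightarrow> l \<le> l' \<Longrightarrow> reach l' g"
  unfolding reach_def using order_trans[of _ l l'] by blast

lemma reach_mult:
  assumes "reach l g" "reach m h"
  shows "reach (l + m) (g \<otimes>\<^bsub>heis\<^esub> h)"
proof -
  obtain us vs where us: "set us \<subseteq> heis_gens" "length us \<le> l" "word_prod heis us = g"
    and vs: "set vs \<subseteq> heis_gens" "length vs \<le> m" "word_prod heis vs = h"
    using assms unfolding reach_def by blast
  have "set (us @ vs) \<subseteq> heis_gens" "length (us @ vs) \<le> l + m"
    "word_prod heis (us @ vs) = g \<otimes>\<^bsub>heis\<^esub> h"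
    using us vs by (auto simp: heis_word_prod_append)
  then show ?thesis unfolding reach_def by blast
qed

text \<open>Such a map acts letter by letter on words. It serves for the reflections below, which
  reverse orientation and hence the sign of the area.\<close>

lemma reach_hom:
  assumes hom: "\<And>g h. f (g \<otimes>\<^bsub>heis\<^esub> h) = f g \<otimes>\<^bsub>heis\<^esub> f h"
    and one: "f (0, 0, 0) = (0, 0, 0)" and gens: "f ` heis_gens \<subseteq> heis_gens"
    and "reach l g"
  shows "reach l (f g)"
proof -
  obtain ws where ws: "set ws \<subseteq> heis_gens" "length ws \<le> l" "word_prod heis ws = g"
    using assms(4) unfolding reach_def by blast
  have "word_prod heis (map f ws) = f (word_prod heis ws)"
    by (induction ws) (simp_all add: word_prod_def hom one)
  then show ?thesis
    unfolding reach_def using ws gens by (intro exI[of _ "map f ws"]) auto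
qed

lemma reach_flip:
  assumes "reach l (a, b, c)"
  shows "reach l (-a, b, -c)"
  using reach_hom[of "\<lambda>(a, b, c). (-a, b, -c)", OF _ _ _ assms]
  by (auto simp: heis_gens_def heis_def)

lemma reach_swap:
  assumes "reach l (a, b, c)"
  shows "reach l (b, a, -c)"
  using reach_hom[of "\<lambda>(a, b, c). (b, a, -c)", OF _ _ _ assms]
  by (auto simp: heis_gens_def heis_def algebra_simps)

lemma reach_x: "reach (nat \<bar>k\<bar>) (k, 0, 0)"
proof -
  have pos: "reach n (int n, 0, 0)" for n
  proof (induction n)
    case 0
    then show ?case by (auto simp: reach_def word_prod_def)
  next
    case (Suc n)
    have "reach 1 (1, 0, 0)"
      unfolding reach_def by (rule exI[of _ "[(1, 0, 0)]"]) (simp add: word_prod_def heis_gens_def)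
    from reach_mult[OF this Suc] show ?case by simp
  qed
  show ?thesis
  proof (cases "k \<ge> 0")
    case True
    then show ?thesis using pos[of "nat k"] by simp
  next
    case False
    then show ?thesis using reach_flip[OF pos[of "nat (-k)"]] by simp
  qed
qed

lemma reach_y: "reach (nat \<bar>k\<bar>) (0, k, 0)"
  using reach_swap[OF reach_x] by simp

section \<open>The rectangle criterion for word length\<close>

definition box :: "int \<Rightarrow> int \<times> int \<times> int \<Rightarrow> bool" where
  "box l = (\<lambda>(a, b, c). \<exists>p q. \<bar>a\<bar> \<le> p \<and> \<bar>b\<bar> \<le> q \<and>
     2 * p + 2 * q - \<bar>a\<bar> - \<bar>b\<bar> \<le> l \<and> \<bar>c\<bar> \<le> 2 * p * q - \<bar>a\<bar> * \<bar>b\<bar>)"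

lemma boxI:
  assumes "\<bar>a\<bar> \<le> p" "\<bar>b\<bar> \<le> q" "2 * p + 2 * q - \<bar>a\<bar> - \<bar>b\<bar> \<le> l"
    "\<bar>c\<bar> \<le> 2 * p * q - \<bar>a\<bar> * \<bar>b\<bar>"
  shows "box l (a, b, c)"
  unfolding box_def using assms by blast

lemma boxE:
  assumes "box l (a, b, c)"
  obtains p q where "\<bar>a\<bar> \<le> p" "\<bar>b\<bar> \<le> q" "2 * p + 2 * q - \<bar>a\<bar> - \<bar>b\<bar> \<le> l"
    "\<bar>c\<bar> \<le> 2 * p * q - \<bar>a\<bar> * \<bar>b\<bar>"
  using assms unfolding box_def by blast

lemma box_mono: "box l g \<Longrightarrow> l \<le> l' \<Longrightarrow> box l' g"
  unfolding box_def by force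

lemma box_swap: "box l (a, b, c) \<longleftrightarrow> box l (b, a, -c)"
proof -
  have "box l (b, a, -c)" if "box l (a, b, c)" for a b c
    using that
  proof (rule boxE)
    fix p q assume "\<bar>a\<bar> \<le> p" "\<bar>b\<bar> \<le> q" "2 * p + 2 * q - \<bar>a\<bar> - \<bar>b\<bar> \<le> l"
      "\<bar>c\<bar> \<le> 2 * p * q - \<bar>a\<bar> * \<bar>b\<bar>"
    then show ?thesis by (intro boxI[of _ q _ p]) (auto simp: mult.commute mult.left_commute)
  qed
  from this[of a b c] this[of b a "-c"] show ?thesis by auto
qed

lemma box_flip: "box l (a, b, c) \<longleftrightarrow> box l (-a, b, -c)"
  unfolding box_def by auto

text \<open>For \<open>a >= 0\<close> the rectangle gets one more column, which adds
  \<open>2q - |b| >= |b|\<close> to the bound on the area. For \<open>a < 0\<close> the same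
  rectangle serves: \<open>|a|\<close> drops by one, which raises the bound by \<open>|b|\<close>
  and the length by one.\<close>

lemma box_x_step:
  assumes "box l (a, b, c)"
  shows "box (l + 1) (a + 1, b, c + b)"
proof -
  obtain p q where pq: "\<bar>a\<bar> \<le> p" "\<bar>b\<bar> \<le> q" "2 * p + 2 * q - \<bar>a\<bar> - \<bar>b\<bar> \<le> l"
    "\<bar>c\<bar> \<le> 2 * p * q - \<bar>a\<bar> * \<bar>b\<bar>"
    using assms by (rule boxE)
  have cb: "\<bar>c + b\<bar> \<le> 2 * p * q - \<bar>a\<bar> * \<bar>b\<bar> + \<bar>b\<bar>" using pq by linarith
  show ?thesis
  proof (cases "a \<ge> 0")
    case True
    have "2 * p * q - \<bar>a\<bar> * \<bar>b\<bar> + \<bar>b\<bar> \<le> 2 * (p + 1) * q - \<bar>a + 1\<bar> * \<bar>b\<bar>"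
      using True pq by (simp add: algebra_simps)
    with cb pq True show ?thesis
      by (intro boxI[of _ "p + 1" _ q]) auto
  next
    case False
    have "2 * p * q - \<bar>a\<bar> * \<bar>b\<bar> + \<bar>b\<bar> = 2 * p * q - \<bar>a + 1\<bar> * \<bar>b\<bar>"
      using False by (simp add: algebra_simps)
    with cb pq False show ?thesis
      by (intro boxI[of _ p _ q]) auto
  qed
qed

lemma box_step:
  assumes "s \<in> heis_gens" "box l g"
  shows "box (l + 1) (s \<otimes>\<^bsub>heis\<^esub> g)"
proof -
  obtain a b c where g: "g = (a, b, c)" by (cases g)
  have g': "box l (a, b, c)" using assms(2) g by simp
  have "box (l + 1) (a + 1, b, c + b)" using box_x_step[OF g'] .
  \<comment> \<open>The other three generators are images of the first under reflections.\<close>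
  moreover have "box (l + 1) (a - 1, b, c - b)"
    using box_x_step[of l "-a" b "-c"] g' box_flip[of l a b c]
      box_flip[of "l + 1" "1 - a" b "b - c"]
    by (simp add: algebra_simps)
  moreover have "box (l + 1) (a, b + 1, c - a)"
    using box_x_step[of l b a "-c"] g' box_swap[of l a b c]
      box_swap[of "l + 1" "b + 1" a "a - c"]
    by (simp add: algebra_simps)
  moreover have "box (l + 1) (a, b - 1, c + a)"
    using box_x_step[of l "-b" a c] g' box_swap[of l a b c] box_flip[of l b a "-c"]
      box_flip[of "l + 1" "1 - b" a "c + a"] box_swap[of "l + 1" "b - 1" a "-(c + a)"]
    by (simp add: algebra_simps)
  moreover have "box (l + 1) (a, b, c)" using box_mono[OF g'] by simp
  ultimately show ?thesis
    using assms(1) by (auto simp: g heis_gens_def add.commute)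
qed

lemma reach_imp_box:
  assumes "reach l g"
  shows "box (int l) g"
proof -
  obtain ws where ws: "set ws \<subseteq> heis_gens" "length ws \<le> l" "word_prod heis ws = g"
    using assms unfolding reach_def by blast
  have "box (int (length ws)) (word_prod heis ws)" using ws(1)
  proof (induction ws)
    case Nil
    show ?case by (auto simp: word_prod_def box_def intro!: exI[of _ 0])
  next
    case (Cons s ws)
    then show ?case
      using box_step[of s "int (length ws)" "word_prod heis ws"]
      by (simp add: word_prod_def add.commute)
  qed
  with ws show ?thesis using box_mono by fastforce
qed

lemma box_imp_reach_nonneg:
  assumes a: "0 \<le> a" "a \<le> p" and b: "0 \<le> b" "b \<le> q" and l: "2 * p + 2 * q - a - b \<le> int l"
    and c: "0 \<le> c" "c \<le> 2 * p * q - a * b" and par: "even (c - a * b)"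
  shows "reach l (a, b, c)"
\<comment> \<open>The rectangle may degenerate only in this case. Otherwise
  \<open>a * b + c > 0\<close>, so fewer than \<open>p * q\<close> squares are to be cut
  off.\<close>
proof (cases "a * b = 0 \<and> c = 0")
  case True
  have "reach (nat \<bar>a\<bar> + nat \<bar>b\<bar>) (a, b, a * b)"
    using reach_mult[OF reach_x[of a] reach_y[of b]] by simp
  then show ?thesis using True a b l by (auto elim!: reach_mono)
next
  case False
  have "a * b \<ge> 0" using a b by simp
  have "p * q > 0"
  proof (rule ccontr)
    assume "\<not> p * q > 0"
    moreover have "p * q \<ge> 0" using a b by simp
    ultimately have "p * q = 0" by linarith
    then have "2 * p * q = 0" by auto
    with c False \<open>a * b \<ge> 0\<close> show False by linarith
  qed
  then have p: "p > 0" and q: "q > 0"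
    using a b by (auto simp: zero_less_mult_iff)
  have "even (2 * p * q - a * b - c)" using par by auto
  then obtain j where j: "2 * p * q - a * b - c = 2 * j" by (elim evenE)
  define s t where "s = j div q" and "t = j mod q"
  have j0: "j \<ge> 0" using j c by simp
  have "a * b + c > 0" using False \<open>a * b \<ge> 0\<close> c(1) by linarith
  then have jlt: "j < p * q" using j by simp
  have st: "j = s * q + t" "0 \<le> t" "t < q" "0 \<le> s"
    using q j0 by (auto simp: s_def t_def pos_imp_zdiv_nonneg_iff)
  have "s < p"
  proof (rule ccontr)
    assume "\<not> s < p"
    then have "p * q \<le> s * q" using q by simp
    with jlt st show False by linarith
  qed
  txt \<open>The path around the \<open>p\<close> by \<open>q\<close> rectangle with \<open>j = sq + t\<close> unit squares cut off at its
    right side: \<open>s\<close> full columns and \<open>t\<close> squares of the next one.\<close>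
  note r = reach_mult[OF reach_mult[OF reach_mult[OF reach_mult[OF reach_mult[OF
    reach_y[of "b - q"] reach_x[of "p - 1 - s"]] reach_y[of t]] reach_x[of 1]]
    reach_y[of "q - t"]] reach_x[of "s - (p - a)"]]
  have "reach (nat \<bar>b - q\<bar> + nat \<bar>p - 1 - s\<bar> + nat \<bar>t\<bar> + nat \<bar>1\<bar> + nat \<bar>q - t\<bar>
      + nat \<bar>s - (p - a)\<bar>) (a, b, 2 * p * q - a * b - 2 * (s * q + t))"
    using r by (simp add: algebra_simps)
  moreover have "nat \<bar>b - q\<bar> + nat \<bar>p - 1 - s\<bar> + nat \<bar>t\<bar> + nat \<bar>1\<bar> + nat \<bar>q - t\<bar>
      + nat \<bar>s - (p - a)\<bar> \<le> l"
  proof -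
    have "\<bar>b - q\<bar> = q - b" "\<bar>p - 1 - s\<bar> = p - 1 - s" "\<bar>t\<bar> = t" "\<bar>q - t\<bar> = q - t"
      using b st \<open>s < p\<close> by simp_all
    \<comment> \<open>The last run goes left if \<open>s < p - a\<close> and right if
      \<open>s > p - a\<close>; its length is bounded in either case.\<close>
    moreover have "\<bar>s - (p - a)\<bar> \<le> s + (p - a)" using a st by simp
    ultimately have "\<bar>b - q\<bar> + \<bar>p - 1 - s\<bar> + \<bar>t\<bar> + 1 + \<bar>q - t\<bar> + \<bar>s - (p - a)\<bar> \<le> int l"
      using l by simp
    then have "int (nat \<bar>b - q\<bar> + nat \<bar>p - 1 - s\<bar> + nat \<bar>t\<bar> + nat \<bar>1\<bar> + nat \<bar>q - t\<bar>
      + nat \<bar>s - (p - a)\<bar>) \<le> int l" by simp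
    then show ?thesis by (simp only: of_nat_le_iff)
  qed
  moreover have "2 * p * q - a * b - 2 * (s * q + t) = c"
    using j unfolding st(1)[symmetric] by linarith
  ultimately show ?thesis using reach_mono by metis
qed

lemma box_imp_reach:
  assumes "box (int l) (a, b, c)" "even (c - a * b)"
  shows "reach l (a, b, c)"
proof -
  have pos: "reach l (a, b, c)"
    if asm: "0 \<le> a" "0 \<le> b" "box (int l) (a, b, c)" "even (c - a * b)" for a b c
  proof -
    obtain p q where pq: "a \<le> p" "b \<le> q" "2 * p + 2 * q - a - b \<le> int l"
      "\<bar>c\<bar> \<le> 2 * p * q - a * b"
      using asm(1,2) boxE[OF asm(3)] by auto
    show ?thesis
    proof (cases "c \<ge> 0")
      case True
      then show ?thesis using box_imp_reach_nonneg[of a p b q l c] pq asm by simp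
    next
      case False
      have "reach l (b, a, -c)"
        using box_imp_reach_nonneg[of b q a p l "-c"] pq asm False
        by (simp add: mult.commute mult.left_commute)
      from reach_swap[OF this] show ?thesis by simp
    qed
  qed
  have pos': "reach l (a, b, c)"
    if "0 \<le> b" "box (int l) (a, b, c)" "even (c - a * b)" for a b c
  proof (cases "a \<ge> 0")
    case False
    then show ?thesis
      using reach_flip[OF pos[of "-a" b "-c"]] that box_flip[of "int l" a b c] by simp
  qed (use pos that in simp)
  show ?thesis
  proof (cases "b \<ge> 0")
    case False
    have "box (int l) (a, -b, -c)"
      using assms(1) unfolding box_def by simp
    then have "reach l (a, -b, -c)" using pos'[of "-b" a "-c"] False assms(2) by simp
    from reach_swap[OF reach_flip[OF reach_swap[OF this]]] show ?thesis by simp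
  qed (use pos' assms in simp)
qed

lemma word_length_box:
  assumes "g \<in> carrier heis"
  shows "word_length heis heis_gens g \<le> l \<longleftrightarrow> box (int l) g"
proof -
  obtain a b c where g: "g = (a, b, c)" by (cases g)
  have "even (c - a * b)" using assms by (simp add: g heis_carrier)
  then show ?thesis
    using word_length_le_iff[OF assms] reach_imp_box box_imp_reach g by blast
qed

lemma word_ball_box:
  assumes "g \<in> carrier heis"
  shows "h \<in> word_ball heis heis_gens l g \<longleftrightarrow>
    h \<in> carrier heis \<and> box (int l) (inv\<^bsub>heis\<^esub> g \<otimes>\<^bsub>heis\<^esub> h)"
proof -
  interpret group heis by (rule heis_group)
  show ?thesis
    using word_length_box[of "inv\<^bsub>heis\<^esub> g \<otimes>\<^bsub>heis\<^esub> h" l] assms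
    by (auto simp: word_ball_def word_dist_def)
qed

section \<open>The set as a limit of balls\<close>

lemma box_large:
  assumes "(u, v) \<noteq> (0, 0)" "2 + \<bar>u\<bar> + \<bar>v\<bar> + \<bar>w\<bar> + \<bar>u\<bar> * \<bar>v\<bar> \<le> k"
  shows "box (4 * k + 1) (u, v, 2 * k * k + 2 + w)"
proof -
  have "\<bar>u\<bar> * \<bar>v\<bar> \<ge> 0" "k * k \<ge> 0" by simp_all
  moreover have "\<bar>u\<bar> + \<bar>v\<bar> \<ge> 1" using assms(1) by auto
  ultimately show ?thesis
    \<comment> \<open>The \<open>k\<close> by \<open>k + 1\<close> rectangle has perimeter
      \<open>4k + 2\<close>, of which an endpoint other than the origin saves at least one. Its
      bound \<open>2k(k + 1)\<close> leaves room for \<open>2 + w\<close>.\<close>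
    using assms(2) by (intro boxI[of _ k _ "k + 1"], unfold distrib_left) linarith+
qed

text \<open>For a closed path the odd radius is worth only \<open>p + q \<le> 2k\<close>, and then
  the square has the largest area.\<close>

lemma box_center:
  assumes "\<bar>w\<bar> \<le> k" "even w"
  shows "box (4 * k + 1) (0, 0, 2 * k * k + 2 + w) \<longleftrightarrow> w < 0"
proof
  assume "box (4 * k + 1) (0, 0, 2 * k * k + 2 + w)"
  then obtain p q where pq: "0 \<le> p" "0 \<le> q" "2 * p + 2 * q \<le> 4 * k + 1"
    "\<bar>2 * k * k + 2 + w\<bar> \<le> 2 * p * q"
    unfolding box_def by auto
  have "(p + q)\<^sup>2 \<le> (2 * k)\<^sup>2" using pq by (intro power_mono) linarith+
  moreover have "(p - q)\<^sup>2 \<ge> 0" by simp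
  ultimately have "2 * p * q \<le> 2 * k * k"
    by (simp add: power2_eq_square algebra_simps)
  with pq show "w < 0" by linarith
next
  assume "w < 0"
  \<comment> \<open>Parity excludes \<open>w = -1\<close>, for which \<open>2k^2 + 1\<close> would
    still exceed the square.\<close>
  then have "w \<le> -2" using assms(2) by (cases "w = -1") auto
  moreover have "k \<le> k * k" using assms(1) by (cases "k = 0") (simp_all add: mult_le_cancel_left1)
  ultimately show "box (4 * k + 1) (0, 0, 2 * k * k + 2 + w)"
    using assms(1) by (intro boxI[of _ k _ k], unfold mult.assoc) linarith+
qed

lemma horoball_center:
  assumes "P = carrier heis - {0} \<times> {0} \<times> \<nat>"
  shows "horoball heis heis_gens P"
proof -
  define g :: "nat \<Rightarrow> int \<times> int \<times> int" where "g k = (0, 0, - (2 * int k * int k + 2))" for k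
  define n :: "nat \<Rightarrow> nat" where "n k = 4 * k + 1" for k
  have g: "g k \<in> carrier heis" for k by (simp add: g_def heis_carrier)
  have ball: "(u, v, w) \<in> word_ball heis heis_gens (n k) (g k) \<longleftrightarrow>
      box (4 * int k + 1) (u, v, 2 * int k * int k + 2 + w)"
    if "(u, v, w) \<in> carrier heis" for u v w k
  proof -
    have "inv\<^bsub>heis\<^esub> g k = (0, 0, 2 * int k * int k + 2)"
      using g[of k] by (simp add: g_def heis_inv)
    then show ?thesis using that by (simp add: word_ball_box[OF g] n_def add.commute)
  qed
  have "set_converges heis (\<lambda>k. word_ball heis heis_gens (n k) (g k)) P"
    unfolding set_converges_def
  proof
    fix h assume h: "h \<in> carrier heis"
    obtain u v w where uvw: "h = (u, v, w)" by (cases h)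
    have carr: "(u, v, w) \<in> carrier heis" using h uvw by simp
    show "eventually (\<lambda>k. (h \<in> word_ball heis heis_gens (n k) (g k)) = (h \<in> P)) sequentially"
    proof (rule eventually_sequentiallyI[of "nat (2 + \<bar>u\<bar> + \<bar>v\<bar> + \<bar>w\<bar> + \<bar>u\<bar> * \<bar>v\<bar>)"])
      fix k assume "nat (2 + \<bar>u\<bar> + \<bar>v\<bar> + \<bar>w\<bar> + \<bar>u\<bar> * \<bar>v\<bar>) \<le> k"
      then have k: "2 + \<bar>u\<bar> + \<bar>v\<bar> + \<bar>w\<bar> + \<bar>u\<bar> * \<bar>v\<bar> \<le> int k" by linarith
      show "(h \<in> word_ball heis heis_gens (n k) (g k)) = (h \<in> P)"
      proof (cases "(u, v) = (0, 0)")
        case True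
        then have "even w" using carr by (simp add: heis_carrier)
        moreover have "h \<in> P \<longleftrightarrow> w < 0"
          using True carr by (auto simp: assms uvw Nats_altdef1)
        ultimately show ?thesis
          using True k ball[OF carr] box_center[of w "int k"] by (simp add: uvw)
      next
        case False
        then have "h \<in> P" using carr by (auto simp: assms uvw)
        with False show ?thesis
          using k ball[OF carr] box_large[of u v w "int k"] by (simp add: uvw)
      qed
    qed
  qed
  moreover have "filterlim n at_top sequentially"
    by (rule filterlim_at_top_mono[OF filterlim_ident]) (simp add: n_def)
  moreover have "(1, 0, 0) \<in> P" "(0, 0, 0) \<notin> P" "(0, 0, 0) \<in> carrier heis" "P \<subseteq> carrier heis"
    by (auto simp: assms heis_carrier)
  ultimately show ?thesis
    unfolding horoball_def using g by blast
qed

section \<open>Peaks and their shape in a quadrant\<close>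

definition rot :: "int \<times> int \<times> int \<Rightarrow> int \<times> int \<times> int" where
  "rot = (\<lambda>(a, b, c). (-b, a, c))"

lemma rot_simp [simp]: "rot (a, b, c) = (-b, a, c)"
  by (simp add: rot_def)

lemma rot_mult: "rot (g \<otimes>\<^bsub>heis\<^esub> h) = rot g \<otimes>\<^bsub>heis\<^esub> rot h"
  by (cases g; cases h) simp

lemma box_rot: "box l (rot g) \<longleftrightarrow> box l g"
proof (cases g)
  case (fields a b c)
  then show ?thesis
    using box_swap[of l a b c] box_flip[of l b a "-c"] by simp
qed

text \<open>The argument in the first quadrant tests \<open>(0, 0, -2)\<close>,
  \<open>(-1, 0, 0)\<close>, \<open>(1, 0, 0)\<close> and \<open>(2, 0, 0)\<close>. The set is the
  closure of these under quarter turns.\<close>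

definition probes :: "(int \<times> int \<times> int) set" where
  "probes = {(1, 0, 0), (-1, 0, 0), (0, 1, 0), (0, -1, 0),
     (2, 0, 0), (-2, 0, 0), (0, 2, 0), (0, -2, 0), (0, 0, -2)}"

lemma rot_probes: "rot ` probes = probes"
  by (auto simp: probes_def)

text \<open>For \<open>n >= 0\<close>: the ball of radius \<open>n\<close> around the inverse of
  \<open>g\<close> contains all probes but not the identity.\<close>

definition peak :: "int \<Rightarrow> int \<times> int \<times> int \<Rightarrow> bool" where
  "peak n g \<longleftrightarrow> g \<in> carrier heis \<and> \<not> box n g \<and> (\<forall>u\<in>probes. box n (g \<otimes>\<^bsub>heis\<^esub> u))"

lemma peak_rot:
  assumes "peak n g"
  shows "peak n (rot g)"
proof -
  have "rot g \<in> carrier heis"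
    using assms by (cases g) (auto simp: peak_def heis_carrier mult.commute)
  moreover have "box n (rot g \<otimes>\<^bsub>heis\<^esub> u)" if u: "u \<in> probes" for u
  proof -
    obtain v where "v \<in> probes" "u = rot v" using u rot_probes by blast
    then show ?thesis using assms by (simp add: peak_def box_rot flip: rot_mult)
  qed
  ultimately show ?thesis using assms by (simp add: peak_def box_rot)
qed

lemma peak_quadrant:
  assumes peak: "peak n (a, b, c)" and a: "a > 0" and b: "b \<ge> 0"
  obtains k where "c = 2 * a * k - a * b + 2" "n = a + 2 * k - b + 1" "b < k" "k + 2 \<le> a"
proof -
  have nb: "\<not> box n (a, b, c)" and par: "even (c - a * b)"
    using peak by (auto simp: peak_def heis_carrier)
  have u: "box n ((a, b, c) \<otimes>\<^bsub>heis\<^esub> u)" if "u \<in> probes" for u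
    using peak that by (simp add: peak_def)
  have bz: "box n (a, b, c - 2)" and bx': "box n (a - 1, b, c + b)"
    and bx: "box n (a + 1, b, c - b)" and bxx: "box n (a + 2, b, c - 2 * b)"
    using u[of "(0, 0, -2)"] u[of "(-1, 0, 0)"] u[of "(1, 0, 0)"] u[of "(2, 0, 0)"]
    by (simp_all add: probes_def)
  have no_box: "2 * p * q - a * b < \<bar>c\<bar>" if "a \<le> p" "b \<le> q" "2 * p + 2 * q - a - b \<le> n" for p q
    using nb that a b unfolding box_def by force
  obtain p q where pq: "a \<le> p" "b \<le> q" "2 * p + 2 * q - a - b \<le> n" "\<bar>c - 2\<bar> \<le> 2 * p * q - a * b"
    using bz a b unfolding box_def by auto
  have "a * b \<le> p * q" "0 \<le> a * b" using pq a b by (simp_all add: mult_mono)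
  moreover have "even (c - (2 * p * q - a * b))" using par by auto
  moreover have "2 * p * q - a * b < \<bar>c\<bar>" using no_box pq by blast
  \<comment> \<open>The bound fails for \<open>c\<close> and holds for \<open>c - 2\<close>, so
    parity makes the excess exactly 2.\<close>
  ultimately have c: "c = 2 * p * q - a * b + 2"
  proof -
    assume "even (c - (2 * p * q - a * b))" "2 * p * q - a * b < \<bar>c\<bar>"
    moreover then obtain j where "c - (2 * p * q - a * b) = 2 * j" by (elim evenE)
    ultimately show ?thesis using pq(4) by presburger
  qed
  have c0: "c > 0" using c \<open>a * b \<le> p * q\<close> \<open>0 \<le> a * b\<close> by (simp add: mult.assoc)
  \<comment> \<open>The \<open>p\<close> by \<open>q\<close> rectangle thus has the largest area
    among those admissible for \<open>(a, b)\<close> and \<open>n\<close>.\<close>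
  have no_box': "p' * q' \<le> p * q" if "a \<le> p'" "b \<le> q'" "2 * p' + 2 * q' - a - b \<le> n" for p' q'
    using no_box[OF that] c0 c by (simp add: mult.assoc)
  obtain p3 q3 where x: "a + 1 \<le> p3" "b \<le> q3" "2 * p3 + 2 * q3 - (a + 1) - b \<le> n"
    "\<bar>c - b\<bar> \<le> 2 * p3 * q3 - (a + 1) * b"
    using bx a b unfolding box_def by auto
  \<comment> \<open>The probe \<open>(1, 0, 0)\<close> yields a larger area, so its rectangle must
    break the length bound for \<open>(a, b)\<close>. It does so by exactly one, which fixes the
    parity of \<open>n\<close>; \<open>R\<close> is then the largest half perimeter allowed.\<close>
  have "p * q < p3 * q3" using x(4) c by (simp add: algebra_simps)
  then have "n < 2 * p3 + 2 * q3 - a - b" using no_box'[of p3 q3] x by linarith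
  define R where "R = p3 + q3 - 1"
  have n: "n = 2 * R - a - b + 1" using x \<open>n < _\<close> by (simp add: R_def)
  have "p + q = R"
  proof (rule ccontr)
    assume "p + q \<noteq> R"
    moreover have "p + q \<le> R" using pq(3) n by linarith
    ultimately have "p + q + 1 \<le> R" by linarith
    then have "p * (q + 1) \<le> p * q" using pq(1-3) n by (intro no_box') auto
    then show False using a pq by (simp add: algebra_simps)
  qed
  obtain p1 q1 where x': "a - 1 \<le> p1" "b \<le> q1" "2 * p1 + 2 * q1 - (a - 1) - b \<le> n"
    "\<bar>c + b\<bar> \<le> 2 * p1 * q1 - (a - 1) * b"
    using bx' a b unfolding box_def by auto
  have lt: "p * q < p1 * q1" using x'(4) c by (simp add: algebra_simps)
  \<comment> \<open>A rectangle of larger area that meets the length bound can only be too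
    narrow.\<close>
  then have "p1 = a - 1" using no_box'[of p1 q1] x' by linarith
  define k where "k = R - a"
  have "q1 \<le> k + 1" using x' \<open>p1 = a - 1\<close> n by (simp add: k_def)
  then have "(a - 1) * q1 \<le> (a - 1) * (k + 1)" using a by (intro mult_left_mono) auto
  with lt \<open>p1 = a - 1\<close> have up: "p * q < (a - 1) * (k + 1)" by simp
  obtain p2 q2 where xx: "a + 2 \<le> p2" "b \<le> q2" "2 * p2 + 2 * q2 - (a + 2) - b \<le> n"
    using bxx a b unfolding box_def by auto
  have kb: "b < k" using xx n by (simp add: k_def)
  \<comment> \<open>The probe \<open>(2, 0, 0)\<close> gave \<open>b < k\<close>, so the
    \<open>a\<close> by \<open>k\<close> rectangle competes too. Now
    \<open>a * k < (a - 1) * (k + 1)\<close> bounds \<open>k\<close>.\<close>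
  have low: "a * k \<le> p * q" using kb n by (intro no_box') (simp_all add: k_def)
  have ka: "k + 2 \<le> a" using up low by (simp add: algebra_simps)
  have "p = a"
  proof (rule ccontr)
    assume "p \<noteq> a"
    \<comment> \<open>With \<open>p + q = a + k\<close>, this product equals
      \<open>a * k - p * q\<close>.\<close>
    then have "0 < (p - a) * (p - k)" using pq ka by (intro mult_pos_pos) linarith+
    moreover have q: "q = a + k - p" using \<open>p + q = R\<close> by (simp add: k_def)
    ultimately show False using low unfolding q by (simp add: algebra_simps)
  qed
  then have "q = k" using \<open>p + q = R\<close> by (simp add: k_def)
  show ?thesis
    using that[of k] c \<open>p = a\<close> \<open>q = k\<close> n kb ka by (simp add: k_def)
qed

section \<open>Sequences of peaks\<close>

definition steps :: "(int \<times> int \<times> int) set" where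
  "steps = {(1, 0, 0), (0, 1, 0), (-1, 0, 0), (0, -1, 0)}"

lemma rot_steps: "s \<in> steps \<Longrightarrow> rot s \<in> steps"
  by (auto simp: steps_def)

text \<open>The equation for the radius determines the new \<open>k'\<close>. The equation for the
  third coordinate then gives \<open>k = b\<close>, \<open>a = 0\<close> or
  \<open>a + b = k + 1\<close> in the first three cases, all impossible.\<close>

lemma peak_step:
  assumes peak: "peak n (a, b, c)" and a: "a > 0" and b: "b \<ge> 0"
    and s: "s \<in> steps" and peak': "peak (n + 1) (s \<otimes>\<^bsub>heis\<^esub> (a, b, c))"
  shows "b > 0 \<and> s = (0, -1, 0)"
proof -
  obtain k where k: "c = 2 * a * k - a * b + 2" "n = a + 2 * k - b + 1" "b < k" "k + 2 \<le> a"
    using peak_quadrant[OF peak a b] .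
  consider "s = (1, 0, 0)" | "s = (0, 1, 0)" | "s = (-1, 0, 0)" | "s = (0, -1, 0)"
    using s by (auto simp: steps_def)
  then show ?thesis
  proof cases
    case 1
    then have "peak (n + 1) (a + 1, b, c + b)" using peak' by (simp add: algebra_simps)
    then obtain k' where k': "c + b = 2 * (a + 1) * k' - (a + 1) * b + 2"
      "n + 1 = a + 1 + 2 * k' - b + 1"
      using peak_quadrant[of "n + 1" "a + 1" b "c + b"] a b by auto
    then have "k' = k" using k by linarith
    with k k' show ?thesis by (simp add: algebra_simps)
  next
    case 2
    then have "peak (n + 1) (a, b + 1, c - a)" using peak' by (simp add: algebra_simps)
    then obtain k' where k': "c - a = 2 * a * k' - a * (b + 1) + 2"
      "n + 1 = a + 2 * k' - (b + 1) + 1"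
      using peak_quadrant[of "n + 1" a "b + 1" "c - a"] a b by auto
    then have "k' = k + 1" using k by linarith
    with k k' a show ?thesis by (simp add: algebra_simps)
  next
    case 3
    then have "peak (n + 1) (a - 1, b, c - b)" using peak' by (simp add: algebra_simps)
    then obtain k' where k': "c - b = 2 * (a - 1) * k' - (a - 1) * b + 2"
      "n + 1 = a - 1 + 2 * k' - b + 1"
      using peak_quadrant[of "n + 1" "a - 1" b "c - b"] k b by auto
    then have "k' = k + 1" using k by linarith
    with k k' b show ?thesis by (simp add: algebra_simps)
  next
    case 4
    then have p: "peak (n + 1) (a, b - 1, c + a)" using peak' by (simp add: algebra_simps)
    have "b \<noteq> 0"
    proof
      assume "b = 0"
      \<comment> \<open>The step leaves the quadrant. After a quarter turn the first coordinate is
        1, too small for \<open>k + 2 \<le> 1\<close> with \<open>k > a > 0\<close>.\<close>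
      then have "peak (n + 1) (1, a, c + a)" using peak_rot[OF p] by simp
      then show False using peak_quadrant[of "n + 1" 1 a "c + a"] a by auto
    qed
    with b 4 show ?thesis by simp
  qed
qed

lemma no_peak_sequence_quadrant:
  assumes "\<forall>m\<ge>N. peak (int m) (f m)" "\<forall>m\<ge>N. \<exists>s\<in>steps. f (Suc m) = s \<otimes>\<^bsub>heis\<^esub> f m"
    "f N = (a, int b, c)" "a > 0"
  shows False
  using assms
proof (induction b arbitrary: N c)
  case (0 N c)
  then obtain s where "s \<in> steps" "f (Suc N) = s \<otimes>\<^bsub>heis\<^esub> f N" by blast
  moreover have "peak (int N) (f N)" "peak (int N + 1) (f (Suc N))"
    using 0(1)[rule_format, of N] 0(1)[rule_format, of "Suc N"] by (simp_all add: add.commute)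
  ultimately show ?case using peak_step[of "int N" a 0 c s] 0 by simp
next
  case (Suc b N c)
  then obtain s where s: "s \<in> steps" "f (Suc N) = s \<otimes>\<^bsub>heis\<^esub> f N" by blast
  moreover have "peak (int N) (f N)" "peak (int N + 1) (f (Suc N))"
    using Suc(2)[rule_format, of N] Suc(2)[rule_format, of "Suc N"] by (simp_all add: add.commute)
  ultimately have "s = (0, -1, 0)"
    using peak_step[of "int N" a "int (Suc b)" c s] Suc.prems by simp
  then have "f (Suc N) = (a, int b, c + a)" using s Suc.prems by simp
  then show ?case using Suc.IH[of "Suc N" "c + a"] Suc.prems by simp
qed

lemma no_peak_sequence_rot:
  assumes "\<forall>m\<ge>N. peak (int m) (f m)" "\<forall>m\<ge>N. \<exists>s\<in>steps. f (Suc m) = s \<otimes>\<^bsub>heis\<^esub> f m"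
    "f N = (a, b, c)" "(a, b) \<noteq> (0, 0)"
  shows False
proof -
  have rotated: "\<forall>m\<ge>N. peak (int m) ((rot ^^ i) (f m))"
    "\<forall>m\<ge>N. \<exists>s\<in>steps. (rot ^^ i) (f (Suc m)) = s \<otimes>\<^bsub>heis\<^esub> (rot ^^ i) (f m)" for i
  proof (induction i)
    case 0
    { case 1 show ?case using assms by simp
    next case 2 show ?case using assms by simp }
  next
    case (Suc i)
    { case 1 show ?case using Suc(1) peak_rot by simp
    next case 2 show ?case using Suc(2) rot_steps rot_mult by (metis funpow.simps(2) o_apply) }
  qed
  have no: False if "(rot ^^ i) (f N) = (a', b', c')" "a' > 0" "b' \<ge> 0" for i a' b' c'
    using no_peak_sequence_quadrant[OF rotated[of i], of a' "nat b'" c'] that by simp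
  \<comment> \<open>The half-open quadrants are the images of the first under quarter turns and
    cover all but the origin.\<close>
  consider "a > 0" "b \<ge> 0" | "a \<le> 0" "b > 0" | "a < 0" "b \<le> 0" | "a \<ge> 0" "b < 0"
    using assms(4) by fastforce
  then show False
  proof cases
    case 1 then show ?thesis using no[of 0 a b c] assms(3) by simp
  next
    case 2 then show ?thesis using no[of 3 b "-a" c] assms(3) by (simp add: numeral_3_eq_3)
  next
    case 3 then show ?thesis using no[of 2 "-a" "-b" c] assms(3) by (simp add: numeral_2_eq_2)
  next
    case 4 then show ?thesis using no[of 1 "-b" a c] assms(3) by simp
  qed
qed

lemma no_peak_sequence:
  assumes "\<forall>m\<ge>N. peak (int m) (f m)" "\<forall>m\<ge>N. \<exists>s\<in>steps. f (Suc m) = s \<otimes>\<^bsub>heis\<^esub> f m"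
  shows False
proof -
  obtain a b c where f: "f N = (a, b, c)" by (cases "f N")
  obtain s where s: "s \<in> steps" "f (Suc N) = s \<otimes>\<^bsub>heis\<^esub> f N" using assms by blast
  show False
  proof (cases "(a, b) = (0, 0)")
    case True
    obtain a' b' c' where "f (Suc N) = (a', b', c')" by (cases "f (Suc N)")
    \<comment> \<open>Every step changes \<open>(a, b)\<close>, so the sequence leaves the center at
      once.\<close>
    moreover then have "(a', b') \<noteq> (0, 0)" using s f True by (auto simp: steps_def)
    ultimately show ?thesis
      using no_peak_sequence_rot[of "Suc N" f a' b' c'] assms by simp
  qed (use no_peak_sequence_rot f assms in blast)
qed

section \<open>The set is not a Busemann horoball\<close>

lemma not_busemann_center:
  assumes P: "P = carrier heis - {0} \<times> {0} \<times> \<nat>"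
  shows "\<not> busemann_horoball heis heis_gens P"
proof
  interpret group heis by (rule heis_group)
  assume "busemann_horoball heis heis_gens P"
  then obtain p where p: "range p \<subseteq> carrier heis" "\<And>i. p (Suc i) \<in> p i <#\<^bsub>heis\<^esub> heis_gens"
    and dist: "\<And>n. word_dist heis heis_gens (p 0) (p n) = n"
    and Pp: "P = (\<Union>n. word_ball heis heis_gens n (p n))"
    unfolding busemann_horoball_def infinite_geodesic_def by auto
  define f where "f i = inv\<^bsub>heis\<^esub> p i" for i
  have pc: "p i \<in> carrier heis" and fc: "f i \<in> carrier heis" for i
    using p(1) by (auto simp: f_def intro!: inv_closed)
  have step: "\<exists>s\<in>steps. f (Suc i) = s \<otimes>\<^bsub>heis\<^esub> f i" for i
  proof -
    obtain s where s: "s \<in> heis_gens" "p (Suc i) = p i \<otimes>\<^bsub>heis\<^esub> s"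
      using p(2)[of i] by (auto simp: l_coset_def)
    have sc: "s \<in> carrier heis" using s heis_gens_carrier by blast
    have "s \<noteq> \<one>\<^bsub>heis\<^esub>"
    proof
      assume "s = \<one>\<^bsub>heis\<^esub>"
      then have "p (Suc i) = p i" using s pc by (simp del: heis_one)
      then show False using dist[of i] dist[of "Suc i"] by simp
    qed
    then have "inv\<^bsub>heis\<^esub> s \<in> steps"
      using s(1) by (auto simp: heis_gens_def steps_def heis_inv heis_carrier)
    moreover have "f (Suc i) = inv\<^bsub>heis\<^esub> s \<otimes>\<^bsub>heis\<^esub> f i"
      using s(2) pc sc by (simp add: f_def inv_mult_group)
    ultimately show ?thesis by blast
  qed
  have mem: "h \<in> P \<longleftrightarrow> (\<exists>n. box (int n) (f n \<otimes>\<^bsub>heis\<^esub> h))" if "h \<in> carrier heis" for h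
    using that by (simp add: Pp word_ball_box[OF pc] f_def)
  \<comment> \<open>The balls along a geodesic are nested, so the finitely many probes all lie in
    every ball from some index \<open>N\<close> on.\<close>
  have mono: "box (int n) (f n \<otimes>\<^bsub>heis\<^esub> h)"
    if "box (int m) (f m \<otimes>\<^bsub>heis\<^esub> h)" "m \<le> n" "h \<in> carrier heis" for m n h
    using that(2)
  proof (induction n rule: dec_induct)
    case (step n)
    obtain s where s: "s \<in> steps" "f (Suc n) = s \<otimes>\<^bsub>heis\<^esub> f n"
      using \<open>\<exists>s\<in>steps. f (Suc n) = s \<otimes>\<^bsub>heis\<^esub> f n\<close> by blast
    then have "s \<in> heis_gens" by (auto simp: steps_def heis_gens_def)
    moreover have "f (Suc n) \<otimes>\<^bsub>heis\<^esub> h = s \<otimes>\<^bsub>heis\<^esub> (f n \<otimes>\<^bsub>heis\<^esub> h)"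
      using s fc that(3) heis_gens_carrier \<open>s \<in> heis_gens\<close> by (auto simp: m_assoc)
    ultimately show ?case using box_step[OF _ step.IH, of s] by (simp add: add.commute)
  qed (use that in simp)
  have probes: "u \<in> carrier heis" "u \<in> P" if "u \<in> probes" for u
    using that by (auto simp: P probes_def heis_carrier Nats_altdef1)
  have "\<exists>m. box (int m) (f m \<otimes>\<^bsub>heis\<^esub> u)" if "u \<in> probes" for u
    using that probes mem by blast
  then obtain M where M: "\<And>u. u \<in> probes \<Longrightarrow> box (int (M u)) (f (M u) \<otimes>\<^bsub>heis\<^esub> u)"
    by metis
  define N where "N = Max (M ` probes)"
  have "finite probes" by (simp add: probes_def)
  then have N: "M u \<le> N" if "u \<in> probes" for u using that by (simp add: N_def)
  have "(0, 0, 0) \<notin> P" "(0, 0, 0) \<in> carrier heis" by (auto simp: P heis_carrier)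
  then have nbox: "\<not> box (int n) (f n)" for n
    using mem[of "(0, 0, 0)"] r_one[OF fc[of n]] by (metis heis_one)
  have "peak (int m) (f m)" if "m \<ge> N" for m
    unfolding peak_def using fc nbox mono[OF M] N probes(1) that by (meson order_trans)
  then show False using no_peak_sequence[of N f] step by blast
qed

theorem theorem8:
  fixes P :: "(int \<times> int \<times> int) set"
  assumes "P = carrier heis - {0} \<times> {0} \<times> \<nat>"
  shows "horoball heis heis_gens P \<and> \<not> busemann_horoball heis heis_gens P"
  using horoball_center[OF assms] not_busemann_center[OF assms] by blast

end
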